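(* Let $G$ be a strongly balanced connected graph with $v(G)=k\ge2$ vertices and $e(G)$ edges, and let $N_G$ be the number of copies of $G$ in the binomial random-connection model $G_H(\mathcal{X}_n)$ with connection probabilities $p_nH(X_i,X_j)$. Suppose that $$\mathrm{Var}\Big[\sum_{\ell=1}^k f_{(\ell)}(X_1)\Big]>0 .$$ Then: a) $\lim_{n\to\infty}\mathbb{P}(N_G=0)=1$ if $p_n\ll n^{-v(G)/e(G)}$; b) $\lim_{n\to\infty}\mathbb{P}(N_G=0)=0$ if $p_n\gg n^{-v(G)/e(G)}$.
   Context: Binomial random-connection model. $X_1,\dots,X_n$ are i.i.d. random points of $\mathbb{R}^d$ with common continuous (atomless) distribution $\mu$, $\mathcal{X}_n=\{X_1,\dots,X_n\}$, $H:\mathbb{R}^d\times\mathbb{R}^d\to[0,1]$ is a symmetric measurable function, and $p_n\in(0,1)$ for each $n$; $\mu$ and $H$ do not depend on $n$. Given $\mathcal{X}_n$, each pair $X_i,X_j$ ($i\ne j$) is connected by an edge (written $X_i\sim X_j$) independently with probability $p_nH(X_i,X_j)$. The resulting random graph is $G_H(\mathcal{X}_n)$. Subgraph count. $G=(V_G,E_G)$ is a simple graph with $v(G)=|V_G|=k$, vertex set identified with $[k]=\{1,\dots,k\}$, $e(G)=|E_G|$, and $a(G)$ is the number of automorphisms of $G$. With $[n]^k_{\neq}:=\{\beta\in[n]^k:\beta(i)\ne\beta(j)\text{ for }i\ne j\}$, $$N_G:=\frac{1}{a(G)}\sum_{\beta\in[n]^k_{\neq}}\ \prod_{\{u,v\}\in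 E_G}\mathbf{1}_{\{X_{\beta(u)}\sim X_{\beta(v)}\}}.$$ For $1\le\ell\le k$, $$f_{(\ell)}(x):=\frac{p_n^{e(G)}}{a(G)}\int_{(\mathbb{R}^d)^{k-1}}\prod_{\{u,v\}\in E_G}H(x_u,x_v)\,\mu^{\otimes(k-1)}(\mathrm{d}x_1,\dots,\mathrm{d}x_{\ell-1},\mathrm{d}x_{\ell+1},\dots,\mathrm{d}x_k),\qquad x_\ell:=x.$$ Since $p_n\in(0,1)$, the variance condition does not depend on $n$. $G$ is strongly balanced if $\dfrac{e(G')}{v(G')-1}\le\dfrac{e(G)}{v(G)-1}$ for every subgraph $G'\subset G$ with $v(G')\ge2$. $f(n)\ll g(n)$, or $g(n)\gg f(n)$, means $f(n)\ge0$, $g(n)>0$ and $\lim_{n\to\infty}f(n)/g(n)=0$. *)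

theory Defs
  imports "HOL-Probability.Probability" "HOL-Combinatorics.Permutations"
begin

section \<open>Finite simple graphs\<close>

text \<open>A graph is a vertex set together with a set of unordered edges, i.e. two-element sets.\<close>

definition simple_graph :: "'v set \<Rightarrow> 'v set set \<Rightarrow> bool" where
  "simple_graph V E \<longleftrightarrow> finite V \<and> (\<forall>e\<in>E. e \<subseteq> V \<and> card e = 2)"

definition subgraph_of :: "'v set \<Rightarrow> 'v set set \<Rightarrow> 'v set \<Rightarrow> 'v set set \<Rightarrow> bool" where
  "subgraph_of V' E' V E \<longleftrightarrow> simple_graph V' E' \<and> V' \<subseteq> V \<and> E' \<subseteq> E"

definition connected_graph :: "'v set \<Rightarrow> 'v set set \<Rightarrow> bool" where
  "connected_graph V E \<longleftrightarrow> V \<noteq> {} \<and> (\<forall>u\<in>V. \<forall>v\<in>V. (u, v) \<in> {(a, b). {a, b} \<in> E}\<^sup>*)"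

definition strongly_balanced :: "'v set \<Rightarrow> 'v set set \<Rightarrow> bool" where
  "strongly_balanced V E \<longleftrightarrow>
     (\<forall>V' E'. subgraph_of V' E' V E \<and> card V' \<ge> 2 \<longrightarrow>
        real (card E') / (real (card V') - 1) \<le> real (card E) / (real (card V) - 1))"

definition num_automorphisms :: "'v set \<Rightarrow> 'v set set \<Rightarrow> nat" where
  "num_automorphisms V E =
     card {\<pi>. \<pi> permutes V \<and> (\<forall>u\<in>V. \<forall>v\<in>V. {\<pi> u, \<pi> v} \<in> E \<longleftrightarrow> {u, v} \<in> E)}"

section \<open>The binomial random-connection model\<close>

text \<open>
  The value \<open>H (x u) (x v)\<close> for an unordered edge \<open>{u, v}\<close>. The order chosen for the
  two endpoints is immaterial, since the kernel \<open>H\<close> is always assumed symmetric.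
\<close>

definition edge_val :: "('a \<Rightarrow> 'a \<Rightarrow> real) \<Rightarrow> (nat \<Rightarrow> 'a) \<Rightarrow> nat set \<Rightarrow> real" where
  "edge_val H x e = H (x (Min e)) (x (Max e))"

definition sigma_points :: "'w measure \<Rightarrow> nat \<Rightarrow> (nat \<Rightarrow> 'w \<Rightarrow> 'a::topological_space) \<Rightarrow> 'w measure"
  where
  "sigma_points M n X =
     vimage_algebra (space M) (\<lambda>\<omega>. \<lambda>i\<in>{1..n}. X i \<omega>) (Pi\<^sub>M {1..n} (\<lambda>_. borel))"

text \<open>
  \<open>edges \<omega>\<close> is the random edge set on the indices \<open>{1..n}\<close>: \<open>{i, j} \<in> edges \<omega>\<close> means that
  \<open>X i\<close> and \<open>X j\<close> are connected. The last assumption says that, conditionally on the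
  points, the events \<open>{i, j} \<in> edges\<close> are independent with probabilities
  \<open>q * H (X i) (X j)\<close>; the singleton sets \<open>S\<close> give the individual conditional probabilities.
\<close>

locale binomial_rcm = prob_space M
  for M :: "'w measure" and n :: nat and X :: "nat \<Rightarrow> 'w \<Rightarrow> 'a::euclidean_space"
    and edges :: "'w \<Rightarrow> nat set set"
    and \<mu> :: "'a measure" and H :: "'a \<Rightarrow> 'a \<Rightarrow> real" and q :: real +
  assumes points_indep: "indep_vars (\<lambda>_. borel) X {1..n}"
    and points_distr: "\<And>i. i \<in> {1..n} \<Longrightarrow> distr M borel (X i) = \<mu>"
    and edges_graph: "\<And>\<omega>. \<omega> \<in> space M \<Longrightarrow> simple_graph {1..n} (edges \<omega>)"
    and edges_measurable:
      "\<And>e. e \<subseteq> {1..n} \<Longrightarrow> card e = 2 \<Longrightarrow> {\<omega> \<in> space M. e \<in> edges \<omega>} \<in> sets M"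
    and edges_cond_indep:
      "\<And>S. S \<subseteq> {e. e \<subseteq> {1..n} \<and> card e = 2} \<Longrightarrow>
         AE \<omega> in M. real_cond_exp M (sigma_points M n X)
             (indicator {\<omega> \<in> space M. \<forall>e\<in>S. e \<in> edges \<omega>}) \<omega>
           = (\<Prod>e\<in>S. q * edge_val H (\<lambda>i. X i \<omega>) e)"

section \<open>Subgraph counts\<close>

text \<open>
  \<open>EG\<close> is the edge set of the fixed graph on \<open>{1..k}\<close>, \<open>E\<close> that of the host graph on \<open>{1..n}\<close>.
  For injective \<open>\<beta>\<close> and an edge \<open>e = {u, v}\<close>, the image \<open>\<beta> ` e\<close> is the pair \<open>{\<beta> u, \<beta> v}\<close>.
\<close>

definition subgraph_count :: "nat \<Rightarrow> nat set set \<Rightarrow> nat \<Rightarrow> nat set set \<Rightarrow> real" where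
  "subgraph_count k EG n E =
     1 / real (num_automorphisms {1..k} EG) *
       (\<Sum>\<beta> | \<beta> \<in> {1..k} \<rightarrow>\<^sub>E {1..n} \<and> inj_on \<beta> {1..k}. \<Prod>e\<in>EG. of_bool (\<beta> ` e \<in> E))"

definition proj_kernel ::
  "'a measure \<Rightarrow> ('a \<Rightarrow> 'a \<Rightarrow> real) \<Rightarrow> real \<Rightarrow> nat \<Rightarrow> nat set set \<Rightarrow> nat \<Rightarrow> 'a \<Rightarrow> real" where
  "proj_kernel \<mu> H q k EG l x =
     q ^ card EG / real (num_automorphisms {1..k} EG) *
       (\<integral>y. (\<Prod>e\<in>EG. edge_val H (y(l := x)) e) \<partial>(Pi\<^sub>M ({1..k} - {l}) (\<lambda>_. \<mu>)))"

text \<open>The index \<open>0\<close> is excluded because \<open>0 powr a = 0\<close> would violate positivity.\<close>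

definition much_less :: "(nat \<Rightarrow> real) \<Rightarrow> (nat \<Rightarrow> real) \<Rightarrow> bool" where
  "much_less f g \<longleftrightarrow> (\<forall>n\<ge>1. 0 \<le> f n \<and> 0 < g n) \<and> (\<lambda>n. f n / g n) \<longlonglongrightarrow> 0"

end

theory Submission
  imports Defs
begin

text \<open>
  Let \<open>k = v(G)\<close>, \<open>e = e(G)\<close>, and let \<open>T\<close> count the injections \<open>\<beta>\<close> of the vertices of \<open>G\<close> into the
  index set whose image is a copy of \<open>G\<close>; then \<open>N\<^sub>G = 0\<close> iff \<open>T = 0\<close>. Part a) is the union bound
  \<open>P(T > 0) \<le> n\<^sup>k p\<^sup>e\<close>. Part b) is Chebyshev's inequality. The positive variance is used only to make
  the density \<open>h = \<integral> \<Prod> H\<close> positive. Vertex-disjoint pairs \<open>(\<beta>, \<gamma>)\<close> contribute nothing to \<open>Var T\<close>. If the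
  images share \<open>j \<ge> 1\<close> vertices, strong balance bounds the number of shared edges by \<open>e j / k\<close>, so the
  pair contributes at most \<open>p\<^sup>2\<^sup>e c\<^sup>j\<close> with \<open>c = p powr (- e / k)\<close>. Summing over all maps \<open>\<gamma>\<close>, injective
  or not, factorises over the vertices of \<open>G\<close> and gives \<open>(n - k + k c)\<^sup>k - (n - k)\<^sup>k\<close>, which is
  \<open>o(n\<^sup>k)\<close> because \<open>c / n \<rightarrow> 0\<close> is exactly the hypothesis \<open>p \<gg> n powr (- k / e)\<close>.
\<close>

section \<open>Graphs and counting\<close>

text \<open>\<open>edge_val\<close> orders the endpoints by size, and \<beta> may reverse that
  order; the symmetry of \<open>H\<close> absorbs the swap.\<close>

lemma edge_val_image:
  assumes sym: "\<And>x y. H x y = H y x" and "inj_on \<beta> e" "card e = 2"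
  shows "edge_val H x (\<beta> ` e) = edge_val H (x \<circ> \<beta>) e"
proof -
  obtain a b where ab: "e = {a, b}" "a < b"
  proof -
    obtain a b where "e = {a, b}" "a \<noteq> b"
      using \<open>card e = 2\<close> by (auto simp: card_2_iff)
    then show ?thesis
      using that[of a b] that[of b a] by (cases "a < b") (auto simp: insert_commute)
  qed
  have "\<beta> a \<noteq> \<beta> b"
    using assms(2) ab by (auto simp: inj_on_def)
  then show ?thesis
    using ab sym[of "x (\<beta> a)" "x (\<beta> b)"] by (cases "\<beta> a < \<beta> b") (auto simp: edge_val_def min_def max_def)
qed

lemma edge_val_cong:
  assumes "card e = 2" "\<And>i. i \<in> e \<Longrightarrow> x i = y i"
  shows "edge_val H x e = edge_val H y e"
proof -
  have "finite e" "e \<noteq> {}"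
    using assms(1) card.infinite by fastforce+
  then show ?thesis
    using assms(2) by (simp add: edge_val_def)
qed

lemma simple_graph_finite_edges: "simple_graph V E \<Longrightarrow> finite E"
  unfolding simple_graph_def by (rule finite_subset[of _ "Pow V"]) auto

lemma edge_val_measurable:
  fixes H :: "'a::euclidean_space \<Rightarrow> 'a \<Rightarrow> real"
  assumes H: "(\<lambda>(x, y). H x y) \<in> borel_measurable (borel \<Otimes>\<^sub>M borel)"
    and "card e = 2" "\<And>i. i \<in> e \<Longrightarrow> X i \<in> borel_measurable M"
  shows "(\<lambda>\<omega>. edge_val H (\<lambda>i. X i \<omega>) e) \<in> borel_measurable M"
proof -
  have "finite e" "e \<noteq> {}"
    using assms(2) card.infinite by fastforce+
  then have [measurable]: "X (Min e) \<in> borel_measurable M" "X (Max e) \<in> borel_measurable M"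
    using assms(3) by auto
  have "(\<lambda>\<omega>. (X (Min e) \<omega>, X (Max e) \<omega>)) \<in> M \<rightarrow>\<^sub>M borel \<Otimes>\<^sub>M borel"
    by measurable
  from measurable_compose[OF this H] show ?thesis
    by (simp add: edge_val_def)
qed

text \<open>Since \<open>(j - 1) / j\<close> increases with \<open>j\<close>, the bound with
  \<open>v - 1\<close> in the denominators implies the one with \<open>v\<close>. Subgraphs on fewer
  than two vertices have no edges and are included, because two copies may share a single
  vertex.\<close>

lemma strongly_balanced_card_edges:
  assumes graph: "simple_graph V E" and bal: "strongly_balanced V E" and "card V \<ge> 2"
    and sub: "subgraph_of V' E' V E"
  shows "real (card E') * real (card V) \<le> real (card E) * real (card V')"
proof (cases "card V' \<ge> 2")
  case False
  have "E' = {}"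
  proof (rule ccontr)
    assume "E' \<noteq> {}"
    then obtain e where "e \<in> E'" by auto
    then have "e \<subseteq> V'" "card e = 2" "finite V'"
      using sub by (auto simp: subgraph_of_def simple_graph_def)
    then show False
      using card_mono[of V' e] False by simp
  qed
  then show ?thesis by simp
next
  case True
  let ?j = "real (card V')" and ?k = "real (card V)" and ?e = "real (card E)"
  have jk: "2 \<le> ?j" "?j \<le> ?k"
    using True card_mono[of V V'] graph sub by (auto simp: subgraph_of_def simple_graph_def)
  have "real (card E') / (?j - 1) \<le> ?e / (?k - 1)"
    using bal sub True by (auto simp: strongly_balanced_def)
  then have "real (card E') * ?k \<le> (?e / (?k - 1) * (?j - 1)) * ?k"
    using jk by (intro mult_right_mono) (simp_all add: pos_divide_le_eq)
  also have "\<dots> = ?e * ((?j - 1) * ?k / (?k - 1))"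
    by simp
  \<comment> \<open>After clearing denominators this is \<open>(j - 1) k \<le> j (k - 1)\<close>,
    that is, \<open>j \<le> k\<close>.\<close>
  also have "\<dots> \<le> ?e * ?j"
    using jk by (intro mult_left_mono) (auto simp: pos_divide_le_eq algebra_simps)
  finally show ?thesis .
qed

section \<open>Counting maps and injections\<close>

text \<open>The summand is a product over the vertices \<open>v\<close> of a factor \<open>c\<close>
  or \<open>1\<close> that depends on \<open>\<gamma> v\<close> alone. As \<gamma> ranges over all
  maps, its values are chosen independently and the sum factorises. For \<open>c = 0\<close> it
  counts the maps that avoid \<open>B\<close>.\<close>

lemma sum_PiE_power_card:
  fixes c :: "'a :: comm_semiring_1"
  assumes "finite V" "finite N" "B \<subseteq> N"
  shows "(\<Sum>\<gamma>\<in>V \<rightarrow>\<^sub>E N. c ^ card {v \<in> V. \<gamma> v \<in> B})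
       = (of_nat (card (N - B)) + of_nat (card B) * c) ^ card V"
proof -
  have "(\<Sum>\<gamma>\<in>V \<rightarrow>\<^sub>E N. c ^ card {v \<in> V. \<gamma> v \<in> B})
      = (\<Sum>\<gamma>\<in>V \<rightarrow>\<^sub>E N. \<Prod>v\<in>V. if \<gamma> v \<in> B then c else 1)"
    using assms(1) by (intro sum.cong refl) (simp add: prod.If_cases Int_def)
  also have "\<dots> = (\<Prod>v\<in>V. \<Sum>y\<in>N. if y \<in> B then c else 1)"
    using assms by (intro prod_sum_PiE[symmetric]) auto
  also have "(\<Sum>y\<in>N. if y \<in> B then c else 1) = of_nat (card (N - B)) + of_nat (card B) * c"
    using assms by (simp add: sum.If_cases Int_absorb1 Diff_eq[symmetric] add.commute)
  finally show ?thesis by simp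
qed

text \<open>The identity is an automorphism, so the normalising factor is a genuine positive number,
  and a sum of nonnegative terms vanishes only if every term does.\<close>

lemma subgraph_count_eq_0_iff:
  assumes "finite EG"
  shows "subgraph_count k EG n Es = 0 \<longleftrightarrow>
    (\<forall>\<beta>. \<beta> \<in> {1..k} \<rightarrow>\<^sub>E {1..n} \<and> inj_on \<beta> {1..k} \<longrightarrow> \<not> (\<forall>e\<in>EG. \<beta> ` e \<in> Es))"
proof -
  let ?A = "{\<pi>. \<pi> permutes {1..k} \<and> (\<forall>u\<in>{1..k}. \<forall>v\<in>{1..k}. {\<pi> u, \<pi> v} \<in> EG \<longleftrightarrow> {u, v} \<in> EG)}"
  let ?I = "{\<beta>. \<beta> \<in> {1..k} \<rightarrow>\<^sub>E {1..n} \<and> inj_on \<beta> {1..k}}"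
  have "id \<in> ?A"
    by (simp add: permutes_id)
  then have "?A \<noteq> {}"
    by blast
  moreover have "finite ?A"
    by (rule finite_subset[OF _ finite_permutations[of "{1..k}"]]) auto
  ultimately have "num_automorphisms {1..k} EG \<noteq> 0"
    unfolding num_automorphisms_def by (simp only: card_eq_0_iff simp_thms not_False_eq_True)
  then have "subgraph_count k EG n Es = 0 \<longleftrightarrow>
      (\<Sum>\<beta>\<in>?I. \<Prod>e\<in>EG. of_bool (\<beta> ` e \<in> Es) :: real) = 0"
    by (simp add: subgraph_count_def)
  also have "\<dots> \<longleftrightarrow> (\<forall>\<beta>\<in>?I. (\<Prod>e\<in>EG. of_bool (\<beta> ` e \<in> Es) :: real) = 0)"
  proof (rule sum_nonneg_eq_0_iff)
    show "finite ?I"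
      by (rule finite_subset[OF _ finite_PiE[of "{1..k}" "\<lambda>_. {1..n}"]]) auto
  qed (simp add: prod_nonneg)
  also have "\<dots> \<longleftrightarrow> (\<forall>\<beta>\<in>?I. \<not> (\<forall>e\<in>EG. \<beta> ` e \<in> Es))"
    using assms by (intro ball_cong refl) (simp add: prod_zero_iff)
  finally show ?thesis
    by blast
qed

text \<open>The count is a falling factorial; divided by \<open>n ^ k\<close> it is a product of
  \<open>k\<close> factors \<open>1 - i / n\<close>, each tending to 1.\<close>

lemma card_injections_tendsto:
  "(\<lambda>n. real (card {\<beta> \<in> {1..k} \<rightarrow>\<^sub>E {1..n}. inj_on \<beta> {1..k}}) / real n ^ k) \<longlonglongrightarrow> 1"
proof -
  have card: "card {\<beta> \<in> {1..k} \<rightarrow>\<^sub>E {1..n}. inj_on \<beta> {1..k}} = (\<Prod>i<k. n - i)" for n :: nat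
    using card_inj_on_subset_funcset[of "{1..k}" "{1..n}" "{1..k}"]
    by (simp add: atLeast0LessThan)
  have "(\<lambda>n. \<Prod>i<k. 1 - real i * (1 / real n)) \<longlonglongrightarrow> 1"
    by (rule tendsto_eq_intros lim_1_over_n refl | simp)+
  moreover have "\<forall>\<^sub>F n in sequentially. (\<Prod>i<k. 1 - real i * (1 / real n))
      = real (card {\<beta> \<in> {1..k} \<rightarrow>\<^sub>E {1..n}. inj_on \<beta> {1..k}}) / real n ^ k"
    \<comment> \<open>For \<open>n > k\<close> no subtraction \<open>n - i\<close> of natural
      numbers is truncated.\<close>
    using eventually_gt_at_top[of k]
  proof eventually_elim
    case (elim n)
    have "(\<Prod>i<k. 1 - real i * (1 / real n)) = (\<Prod>i<k. real (n - i) / real n)"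
      using elim by (intro prod.cong) (auto simp: field_simps)
    then show ?case
      by (simp only: card prod_dividef of_nat_prod prod_constant card_lessThan)
  qed
  ultimately show ?thesis
    by (rule Lim_transform_eventually)
qed

lemma card_injections_le:
  "card {\<beta> \<in> {1..k} \<rightarrow>\<^sub>E {1..n}. inj_on \<beta> {1..k}} \<le> n ^ k"
proof -
  have "card {\<beta> \<in> {1..k} \<rightarrow>\<^sub>E {1..n}. inj_on \<beta> {1..k}} \<le> card ({1..k} \<rightarrow>\<^sub>E {1..n})"
    by (intro card_mono finite_PiE) auto
  then show ?thesis by (simp add: card_funcsetE)
qed

text \<open>Divide numerator and denominator by \<open>n ^ k\<close>. The denominator tends to 1,
  and the numerator becomes a difference of two \<open>k\<close>-th powers whose bases
  \<open>1 - k / n + k c / n\<close> and \<open>1 - k / n\<close> both tend to 1. Here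
  \<open>c / n\<close> is the power \<open>e / k\<close> of the ratio \<open>r\<close> that the
  hypothesis sends to 0.\<close>

lemma overlap_sum_tendsto:
  fixes p :: "nat \<Rightarrow> real"
  assumes "k > 0" "e > 0" and p: "\<And>n. n \<ge> 1 \<Longrightarrow> 0 < p n"
    and ml: "much_less (\<lambda>n. real n powr (- (real k / real e))) p"
  shows "(\<lambda>n. ((real n - real k + real k * p n powr - (real e / real k)) ^ k - (real n - real k) ^ k)
     / real (card {\<beta> \<in> {1..k} \<rightarrow>\<^sub>E {1..n}. inj_on \<beta> {1..k}})) \<longlonglongrightarrow> 0"
proof -
  define r where "r n = real n powr (- (real k / real e)) / p n" for n
  define c where "c n = p n powr - (real e / real k)" for n
  have "r \<longlonglongrightarrow> 0"
    using ml by (simp add: much_less_def r_def[abs_def])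
  moreover have "\<forall>\<^sub>F n in sequentially. r n \<ge> 0"
    using eventually_ge_at_top[of 1] by eventually_elim (use p in \<open>auto simp: r_def less_imp_le\<close>)
  ultimately have r: "(\<lambda>n. r n powr (real e / real k)) \<longlonglongrightarrow> 0"
    using assms by (intro tendsto_zero_powrI[where b="real e / real k"]) auto
  have cr: "c n / real n = r n powr (real e / real k)" if "n \<ge> 1" for n
    using that p[of n] assms
    by (simp add: c_def r_def powr_divide powr_mult powr_powr powr_minus field_simps)
  have "(\<lambda>n. ((1 - real k * (1 / real n) + real k * r n powr (real e / real k)) ^ k
            - (1 - real k * (1 / real n)) ^ k)
        / (real (card {\<beta> \<in> {1..k} \<rightarrow>\<^sub>E {1..n}. inj_on \<beta> {1..k}}) / real n ^ k))
      \<longlonglongrightarrow> 0"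
    by (rule tendsto_eq_intros r lim_1_over_n card_injections_tendsto refl | simp)+
  moreover have "\<forall>\<^sub>F n in sequentially.
       ((1 - real k * (1 / real n) + real k * r n powr (real e / real k)) ^ k
            - (1 - real k * (1 / real n)) ^ k)
        / (real (card {\<beta> \<in> {1..k} \<rightarrow>\<^sub>E {1..n}. inj_on \<beta> {1..k}}) / real n ^ k)
     = ((real n - real k + real k * c n) ^ k - (real n - real k) ^ k)
     / real (card {\<beta> \<in> {1..k} \<rightarrow>\<^sub>E {1..n}. inj_on \<beta> {1..k}})"
    using eventually_ge_at_top[of 1]
  proof eventually_elim
    case (elim n)
    have "1 - real k * (1 / real n) + real k * r n powr (real e / real k)
        = (real n - real k + real k * c n) / real n"
      using elim by (simp add: cr[symmetric] field_simps)
    moreover have "1 - real k * (1 / real n) = (real n - real k) / real n"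
      using elim by (simp add: field_simps)
    ultimately show ?case
      using elim by (simp add: power_divide diff_divide_distrib[symmetric])
  qed
  ultimately show ?thesis
    unfolding c_def by (rule Lim_transform_eventually)
qed

text \<open>The homomorphism density of the graph in the kernel \<open>H\<close>. The factor
  \<open>q ^ card E\<close> is left out, so that the quantity is the same for all
  \<open>n\<close>.\<close>

definition hom_density ::
  "'a measure \<Rightarrow> ('a \<Rightarrow> 'a \<Rightarrow> real) \<Rightarrow> nat set \<Rightarrow> nat set set \<Rightarrow> real" where
  "hom_density \<mu> H V E = (\<integral>y. (\<Prod>e\<in>E. edge_val H y e) \<partial>(Pi\<^sub>M V (\<lambda>_. \<mu>)))"

section \<open>Moments of the number of copies\<close>

text \<open>Adds the standing hypotheses on the kernel, so that moments can be computed for one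
  fixed \<open>n\<close> with \<open>q\<close> in place of \<open>p n\<close>.\<close>

locale symmetric_rcm = binomial_rcm M n X edges \<mu> H q
  for M :: "'w measure" and n :: nat and X :: "nat \<Rightarrow> 'w \<Rightarrow> 'a::euclidean_space"
    and edges :: "'w \<Rightarrow> nat set set"
    and \<mu> :: "'a measure" and H :: "'a \<Rightarrow> 'a \<Rightarrow> real" and q :: real +
  assumes H_measurable: "(\<lambda>(x, y). H x y) \<in> borel_measurable (borel \<Otimes>\<^sub>M borel)"
    and H_sym: "\<And>x y. H x y = H y x"
    and H_bounds: "\<And>x y. 0 \<le> H x y \<and> H x y \<le> 1"
    and q_bounds: "0 < q" "q < 1"
begin

section \<open>Probability that prescribed edges are present\<close>

lemma edge_val_bounds: "0 \<le> edge_val H x e" "edge_val H x e \<le> 1"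
  using H_bounds by (auto simp: edge_val_def)

lemma points_measurable: "i \<in> {1..n} \<Longrightarrow> X i \<in> borel_measurable M"
  using points_indep by (auto simp: indep_vars_def)

lemma edge_val_points_measurable:
  assumes "e \<subseteq> {1..n}" "card e = 2"
  shows "(\<lambda>\<omega>. edge_val H (\<lambda>i. X i \<omega>) e) \<in> borel_measurable M"
  using assms by (intro edge_val_measurable H_measurable points_measurable) auto

lemma subalgebra_sigma_points: "subalgebra M (sigma_points M n X)"
  unfolding subalgebra_def sigma_points_def
  by (intro conjI sets_image_in_sets measurable_restrict points_measurable) simp_all

lemma edges_subset_event:
  assumes "S \<subseteq> {e. e \<subseteq> {1..n} \<and> card e = 2}"
  shows "{\<omega> \<in> space M. \<forall>e\<in>S. e \<in> edges \<omega>} \<in> sets M"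
proof -
  have "finite S"
    using assms by (rule finite_subset) auto
  then show ?thesis
    using assms edges_measurable by (intro sets.sets_Collect_finite_All) auto
qed

text \<open>Condition on the points: the conditional probability is the product of the edge
  probabilities, and its expectation is the unconditional one.\<close>

lemma prob_edges_subset:
  assumes S: "S \<subseteq> {e. e \<subseteq> {1..n} \<and> card e = 2}"
  shows "prob {\<omega> \<in> space M. \<forall>e\<in>S. e \<in> edges \<omega>}
       = q ^ card S * expectation (\<lambda>\<omega>. \<Prod>e\<in>S. edge_val H (\<lambda>i. X i \<omega>) e)"
proof -
  interpret finite_measure_subalgebra M "sigma_points M n X"
    by standard (rule subalgebra_sigma_points)
  let ?A = "{\<omega> \<in> space M. \<forall>e\<in>S. e \<in> edges \<omega>}"
  let ?F = "sigma_points M n X"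
  have A: "?A \<in> sets M"
    using edges_subset_event[OF S] .
  have [measurable]: "(\<lambda>\<omega>. edge_val H (\<lambda>i. X i \<omega>) e) \<in> borel_measurable M" if "e \<in> S" for e
    using that S by (intro edge_val_points_measurable) auto
  have "prob ?A = expectation (real_cond_exp M ?F (indicator ?A))"
    using A by (subst real_cond_exp_int(2)) (auto simp: emeasure_eq_measure)
  also have "\<dots> = expectation (\<lambda>\<omega>. \<Prod>e\<in>S. q * edge_val H (\<lambda>i. X i \<omega>) e)"
    by (intro integral_cong_AE edges_cond_indep[OF S]) auto
  also have "\<dots> = q ^ card S * expectation (\<lambda>\<omega>. \<Prod>e\<in>S. edge_val H (\<lambda>i. X i \<omega>) e)"
    by (simp add: prod.distrib)
  finally show ?thesis .
qed

lemma integrable_edge_vals: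
  assumes S: "S \<subseteq> {e. e \<subseteq> {1..n} \<and> card e = 2}"
  shows "integrable M (\<lambda>\<omega>. \<Prod>e\<in>S. edge_val H (\<lambda>i. X i \<omega>) e)"
  using S edge_val_bounds
  by (intro integrable_const_bound[where B=1] borel_measurable_prod edge_val_points_measurable)
     (auto simp: abs_prod intro!: prod_le_1)

text \<open>As \<open>H\<close> is at most 1, each prescribed edge costs at most a factor
  \<open>q\<close>. This crude bound suffices for the union bound and for pairs of overlapping
  copies.\<close>

lemma prob_edges_subset_le:
  assumes S: "S \<subseteq> {e. e \<subseteq> {1..n} \<and> card e = 2}"
  shows "prob {\<omega> \<in> space M. \<forall>e\<in>S. e \<in> edges \<omega>} \<le> q ^ card S"
proof -
  have "expectation (\<lambda>\<omega>. \<Prod>e\<in>S. edge_val H (\<lambda>i. X i \<omega>) e) \<le> 1"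
    using integrable_edge_vals[OF S]
    by (rule integral_le_const) (auto intro!: prod_le_1 edge_val_bounds)
  then show ?thesis
    using q_bounds mult_left_mono[of _ 1 "q ^ card S"] by (simp add: prob_edges_subset[OF S])
qed

section \<open>Copies placed by one map or by a pair of maps\<close>

definition copy_event :: "nat set set \<Rightarrow> (nat \<Rightarrow> nat) \<Rightarrow> 'w set" where
  "copy_event E \<beta> = {\<omega> \<in> space M. \<forall>e\<in>E. \<beta> ` e \<in> edges \<omega>}"

context
  fixes V :: "nat set" and E :: "nat set set"
  assumes graph: "simple_graph V E" and V_ne: "V \<noteq> {}"
begin

text \<open>Injectivity on vertices passes to edges: images remain two-element sets and distinct
  edges stay distinct, so the power of \<open>q\<close> for a copy is exactly
  \<open>card E\<close>.\<close>

lemma image_edges: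
  assumes "\<beta> \<in> V \<rightarrow> {1..n}" "inj_on \<beta> V"
  shows "(`) \<beta> ` E \<subseteq> {e. e \<subseteq> {1..n} \<and> card e = 2}" "inj_on ((`) \<beta>) E"
proof -
  have E: "e \<subseteq> V" "card e = 2" if "e \<in> E" for e
    using graph that by (auto simp: simple_graph_def)
  show "(`) \<beta> ` E \<subseteq> {e. e \<subseteq> {1..n} \<and> card e = 2}"
    using E assms by (fastforce simp: card_image inj_on_subset)
  show "inj_on ((`) \<beta>) E"
    using E(1) by (intro inj_onI) (simp add: inj_on_image_eq_iff[OF assms(2)])
qed

lemma copy_event_eq: "copy_event E \<beta> = {\<omega> \<in> space M. \<forall>e\<in>(`) \<beta> ` E. e \<in> edges \<omega>}"
  by (auto simp: copy_event_def)

lemma copy_event_measurable: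
  assumes "\<beta> \<in> V \<rightarrow> {1..n}" "inj_on \<beta> V"
  shows "copy_event E \<beta> \<in> sets M"
  unfolding copy_event_eq by (intro edges_subset_event image_edges assms)

lemma prob_copy_event_le:
  assumes "\<beta> \<in> V \<rightarrow> {1..n}" "inj_on \<beta> V"
  shows "prob (copy_event E \<beta>) \<le> q ^ card E"
  unfolding copy_event_eq
  using prob_edges_subset_le[OF image_edges(1)[OF assms]]
  by (simp only: card_image[OF image_edges(2)[OF assms]])

text \<open>An injection selects distinct points, which are i.i.d. with law \<mu>. Their joint law
  is the product measure on \<open>V\<close>, whichever injection is taken.\<close>

lemma expectation_edge_vals:
  assumes \<beta>: "\<beta> \<in> V \<rightarrow> {1..n}" "inj_on \<beta> V"
  shows "expectation (\<lambda>\<omega>. \<Prod>e\<in>(`) \<beta> ` E. edge_val H (\<lambda>i. X i \<omega>) e) = hom_density \<mu> H V E"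
proof -
  have E: "e \<subseteq> V" "card e = 2" if "e \<in> E" for e
    using graph that by (auto simp: simple_graph_def)
  have rv: "random_variable borel (X (\<beta> i))" if "i \<in> V" for i
    using that \<beta> by (intro points_measurable) auto
  have indep: "indep_vars (\<lambda>_. borel) (\<lambda>i. X (\<beta> i)) V"
  proof -
    \<comment> \<open>Reindexing along \<beta>: group the points into the blocks
      \<open>{\<beta> j}\<close>, disjoint by injectivity, then read off the only coordinate of each
      block.\<close>
    have "indep_vars (\<lambda>j. PiM {\<beta> j} (\<lambda>_. borel)) (\<lambda>j \<omega>. \<lambda>i\<in>{\<beta> j}. X i \<omega>) V"
      using \<beta> by (intro indep_vars_restrict[OF points_indep]) (auto simp: disjoint_family_on_def inj_on_def)
    from indep_vars_compose2[OF this, where Y="\<lambda>j f. f (\<beta> j)" and N="\<lambda>_. borel"] show ?thesis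
      by simp
  qed
  have distr: "distr M (\<Pi>\<^sub>M i\<in>V. borel) (\<lambda>\<omega>. \<lambda>i\<in>V. X (\<beta> i) \<omega>) = (\<Pi>\<^sub>M i\<in>V. \<mu>)"
    using indep_vars_iff_distr_eq_PiM'[where I=V and M'="\<lambda>_. borel" and X="\<lambda>i. X (\<beta> i)"] V_ne rv indep \<beta>
    by (auto simp: points_distr Pi_iff cong: PiM_cong)
  have "expectation (\<lambda>\<omega>. \<Prod>e\<in>(`) \<beta> ` E. edge_val H (\<lambda>i. X i \<omega>) e)
      = expectation (\<lambda>\<omega>. \<Prod>e\<in>E. edge_val H (\<lambda>i. X i \<omega>) (\<beta> ` e))"
    by (simp add: prod.reindex[OF image_edges(2)[OF \<beta>]])
  also have "\<dots> = expectation (\<lambda>\<omega>. \<Prod>e\<in>E. edge_val H (\<lambda>i\<in>V. X (\<beta> i) \<omega>) e)"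
  proof (intro Bochner_Integration.integral_cong refl prod.cong)
    fix \<omega> e assume "e \<in> E"
    then have "edge_val H (\<lambda>i. X i \<omega>) (\<beta> ` e) = edge_val H ((\<lambda>i. X i \<omega>) \<circ> \<beta>) e"
      using E \<beta> by (intro edge_val_image H_sym) (auto intro: inj_on_subset)
    also have "\<dots> = edge_val H (\<lambda>i\<in>V. X (\<beta> i) \<omega>) e"
      using E \<open>e \<in> E\<close> by (intro edge_val_cong) auto
    finally show "edge_val H (\<lambda>i. X i \<omega>) (\<beta> ` e) = edge_val H (\<lambda>i\<in>V. X (\<beta> i) \<omega>) e" .
  qed
  also have "\<dots> = (\<integral>y. (\<Prod>e\<in>E. edge_val H y e)
      \<partial>distr M (\<Pi>\<^sub>M i\<in>V. borel) (\<lambda>\<omega>. \<lambda>i\<in>V. X (\<beta> i) \<omega>))"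
    using E rv
    by (intro integral_distr[symmetric] borel_measurable_prod measurable_restrict
          edge_val_measurable[where X="\<lambda>i y. y i"] H_measurable measurable_component_singleton) auto
  also have "\<dots> = hom_density \<mu> H V E"
    unfolding distr by (simp add: hom_density_def)
  finally show ?thesis .
qed

lemma prob_copy_event:
  assumes "\<beta> \<in> V \<rightarrow> {1..n}" "inj_on \<beta> V"
  shows "prob (copy_event E \<beta>) = q ^ card E * hom_density \<mu> H V E"
  unfolding copy_event_eq prob_edges_subset[OF image_edges(1)[OF assms]]
  by (simp only: expectation_edge_vals[OF assms] card_image[OF image_edges(2)[OF assms]])

text \<open>The two copies share no edge, so the powers of \<open>q\<close> multiply; their
  \<open>H\<close>-products depend on disjoint blocks of points, so the expectations multiply as
  well.\<close>

lemma prob_copy_event_disjoint: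
  assumes \<beta>: "\<beta> \<in> V \<rightarrow> {1..n}" "inj_on \<beta> V" and \<gamma>: "\<gamma> \<in> V \<rightarrow> {1..n}" "inj_on \<gamma> V"
    and disj: "\<beta> ` V \<inter> \<gamma> ` V = {}"
  shows "prob (copy_event E \<beta> \<inter> copy_event E \<gamma>)
    = prob (copy_event E \<beta>) * prob (copy_event E \<gamma>)"
proof -
  have E: "e \<subseteq> V" "card e = 2" if "e \<in> E" for e
    using graph that by (auto simp: simple_graph_def)
  note B = image_edges[OF \<beta>] and C = image_edges[OF \<gamma>]
  let ?B = "(`) \<beta> ` E" and ?C = "(`) \<gamma> ` E"
  let ?F = "\<lambda>S y. \<Prod>e\<in>S. edge_val H y e"
  have fin: "finite ?B" "finite ?C"
    using simple_graph_finite_edges[OF graph] by auto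
  \<comment> \<open>A common edge is nonempty and would provide a common vertex.\<close>
  have disjE: "?B \<inter> ?C = {}"
  proof (rule ccontr)
    assume "?B \<inter> ?C \<noteq> {}"
    then obtain e f where "e \<in> E" "f \<in> E" "\<beta> ` e = \<gamma> ` f"
      by auto
    moreover from this have "e \<noteq> {}"
      using E(2) by fastforce
    ultimately show False
      using disj E(1) by blast
  qed
  have meas: "?F ((`) \<delta> ` E) \<in> borel_measurable (\<Pi>\<^sub>M i\<in>\<delta> ` V. borel)"
    if "\<delta> \<in> V \<rightarrow> {1..n}" "inj_on \<delta> V" for \<delta>
    using E image_edges[OF that]
    by (intro borel_measurable_prod edge_val_measurable[where X="\<lambda>i y. y i"] H_measurable
              measurable_component_singleton) auto
  \<comment> \<open>Each product is a function of its own block of points only, which is the form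
    that independence of blocks requires.\<close>
  have restr: "?F ((`) \<delta> ` E) (\<lambda>i\<in>\<delta> ` V. X i \<omega>) = ?F ((`) \<delta> ` E) (\<lambda>i. X i \<omega>)"
    if "\<delta> \<in> V \<rightarrow> {1..n}" "inj_on \<delta> V" for \<delta> \<omega>
    using image_edges[OF that] by (intro prod.cong edge_val_cong) (auto dest: subsetD[OF E(1)])
  have "indep_var borel (?F ?B \<circ> (\<lambda>\<omega>. \<lambda>i\<in>\<beta> ` V. X i \<omega>)) borel (?F ?C \<circ> (\<lambda>\<omega>. \<lambda>i\<in>\<gamma> ` V. X i \<omega>))"
    using \<beta> \<gamma> disj
    by (intro indep_var_compose[OF indep_var_restrict[OF points_indep]] meas) auto
  then have indep: "indep_var borel (\<lambda>\<omega>. ?F ?B (\<lambda>i. X i \<omega>)) borel (\<lambda>\<omega>. ?F ?C (\<lambda>i. X i \<omega>))"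
    by (simp only: o_def restr[OF \<beta>] restr[OF \<gamma>])
  have "copy_event E \<beta> \<inter> copy_event E \<gamma> = {\<omega> \<in> space M. \<forall>e\<in>?B \<union> ?C. e \<in> edges \<omega>}"
    by (auto simp: copy_event_def)
  then have "prob (copy_event E \<beta> \<inter> copy_event E \<gamma>)
      = q ^ card (?B \<union> ?C) * expectation (\<lambda>\<omega>. ?F (?B \<union> ?C) (\<lambda>i. X i \<omega>))"
    using B C by (simp only:) (intro prob_edges_subset, auto)
  also have "\<dots> = q ^ card ?B * q ^ card ?C *
      expectation (\<lambda>\<omega>. ?F ?B (\<lambda>i. X i \<omega>) * ?F ?C (\<lambda>i. X i \<omega>))"
    by (simp add: card_Un_disjoint prod.union_disjoint fin disjE power_add)
  also have "\<dots> = q ^ card ?B * q ^ card ?C *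
      (expectation (\<lambda>\<omega>. ?F ?B (\<lambda>i. X i \<omega>)) * expectation (\<lambda>\<omega>. ?F ?C (\<lambda>i. X i \<omega>)))"
    using indep_var_lebesgue_integral[OF indep] integrable_edge_vals[OF B(1)] integrable_edge_vals[OF C(1)]
    by simp
  also have "\<dots> = prob (copy_event E \<beta>) * prob (copy_event E \<gamma>)"
    unfolding copy_event_eq prob_edges_subset[OF B(1)] prob_edges_subset[OF C(1)] by simp
  finally show ?thesis .
qed

text \<open>With \<open>e'\<close> shared edges the union has \<open>2 e - e'\<close> edges. Pulled
  back along \<gamma>, the shared edges form a subgraph on the \<open>j\<close> shared vertices, so
  strong balance gives \<open>e' \<le> e j / k\<close>.\<close>

lemma prob_copy_event_overlap:
  assumes \<beta>: "\<beta> \<in> V \<rightarrow> {1..n}" "inj_on \<beta> V" and \<gamma>: "\<gamma> \<in> V \<rightarrow> {1..n}" "inj_on \<gamma> V"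
    and bal: "strongly_balanced V E" "card V \<ge> 2"
  shows "prob (copy_event E \<beta> \<inter> copy_event E \<gamma>)
    \<le> q ^ (2 * card E) * (q powr - (card E / card V)) ^ card {v \<in> V. \<gamma> v \<in> \<beta> ` V}"
proof -
  note B = image_edges[OF \<beta>] and C = image_edges[OF \<gamma>]
  let ?B = "(`) \<beta> ` E" and ?C = "(`) \<gamma> ` E"
  let ?V' = "{v \<in> V. \<gamma> v \<in> \<beta> ` V}" and ?E' = "{e \<in> E. \<gamma> ` e \<in> ?B}"
  have finE: "finite E"
    using simple_graph_finite_edges[OF graph] .
  have E: "e \<subseteq> V" "card e = 2" if "e \<in> E" for e
    using graph that by (auto simp: simple_graph_def)
  \<comment> \<open>Both endpoints of a shared edge are shared vertices.\<close>
  have "e \<subseteq> ?V'" if "e \<in> ?E'" for e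
  proof -
    obtain f where "f \<in> E" "\<gamma> ` e = \<beta> ` f"
      using \<open>e \<in> ?E'\<close> by auto
    then show ?thesis
      using E(1)[of f] E(1)[of e] that by blast
  qed
  then have "subgraph_of ?V' ?E' V E"
    using graph by (simp add: subgraph_of_def simple_graph_def)
  then have "real (card ?E') * real (card V) \<le> real (card E) * real (card ?V')"
    using strongly_balanced_card_edges graph bal by blast
  then have e': "real (card ?E') \<le> real (card E) / real (card V) * real (card ?V')"
    using bal by (simp add: field_simps)
  have "card (?B \<inter> ?C) = card ?E'"
  proof -
    have eq: "?B \<inter> ?C = (`) \<gamma> ` ?E'"
      by blast
    have "inj_on ((`) \<gamma>) ?E'"
      by (rule inj_on_subset[OF C(2)]) auto
    then show ?thesis
      by (simp only: eq card_image)
  qed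
  then have "card (?B \<union> ?C) + card ?E' = 2 * card E"
    using card_Un_Int[of ?B ?C] finE by (simp add: card_image[OF B(2)] card_image[OF C(2)])
  then have card: "real (card (?B \<union> ?C)) = 2 * real (card E) - real (card ?E')"
    by linarith
  have "copy_event E \<beta> \<inter> copy_event E \<gamma> = {\<omega> \<in> space M. \<forall>e\<in>?B \<union> ?C. e \<in> edges \<omega>}"
    by (auto simp: copy_event_def)
  then have "prob (copy_event E \<beta> \<inter> copy_event E \<gamma>) \<le> q ^ card (?B \<union> ?C)"
    using B C by (simp only:) (intro prob_edges_subset_le, auto)
  \<comment> \<open>The exponent \<open>e j / k\<close> need not be an integer, hence
    \<open>powr\<close>; as \<open>q < 1\<close>, a smaller exponent gives a larger power.\<close>
  also have "\<dots> = q powr (2 * real (card E) - real (card ?E'))"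
    using q_bounds by (simp only: card[symmetric] powr_realpow)
  also have "\<dots> \<le> q powr (2 * real (card E) - real (card E) / real (card V) * real (card ?V'))"
    using q_bounds e' by (intro powr_mono') auto
  also have "\<dots> = q powr real (2 * card E) * (q powr - (card E / card V)) powr real (card ?V')"
    by (simp only: powr_powr powr_add[symmetric]) simp
  also have "\<dots> = q ^ (2 * card E) * (q powr - (card E / card V)) ^ card ?V'"
    using q_bounds by (simp only: powr_realpow powr_gt_zero)
  finally show ?thesis .
qed

section \<open>First and second moments of the copy number\<close>

definition copy_number :: "'w \<Rightarrow> real" where
  "copy_number \<omega> = (\<Sum>\<beta> | \<beta> \<in> V \<rightarrow>\<^sub>E {1..n} \<and> inj_on \<beta> V. indicator (copy_event E \<beta>) \<omega>)"

lemma finite_injections: "finite {\<beta> \<in> V \<rightarrow>\<^sub>E {1..n}. inj_on \<beta> V}"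
  using graph by (intro finite_subset[OF _ finite_PiE[of V "\<lambda>_. {1..n}"]]) (auto simp: simple_graph_def)

lemma injectionsD:
  assumes "\<beta> \<in> {\<beta> \<in> V \<rightarrow>\<^sub>E {1..n}. inj_on \<beta> V}"
  shows "\<beta> \<in> V \<rightarrow> {1..n}" "inj_on \<beta> V"
  using assms by (auto simp: PiE_iff)

lemma expectation_copy_number:
  "expectation copy_number =
     card {\<beta> \<in> V \<rightarrow>\<^sub>E {1..n}. inj_on \<beta> V} * (q ^ card E * hom_density \<mu> H V E)"
proof -
  have "expectation copy_number =
      (\<Sum>\<beta> | \<beta> \<in> V \<rightarrow>\<^sub>E {1..n} \<and> inj_on \<beta> V. prob (copy_event E \<beta>))"
    unfolding copy_number_def[abs_def] using copy_event_measurable[OF injectionsD]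
    by (subst Bochner_Integration.integral_sum) (auto simp: emeasure_eq_measure)
  also have "\<dots> = (\<Sum>\<beta> | \<beta> \<in> V \<rightarrow>\<^sub>E {1..n} \<and> inj_on \<beta> V. q ^ card E * hom_density \<mu> H V E)"
    by (intro sum.cong refl prob_copy_event injectionsD)
  finally show ?thesis by simp
qed

lemma copy_number_square:
  "(copy_number \<omega>)\<^sup>2 = (\<Sum>\<beta> | \<beta> \<in> V \<rightarrow>\<^sub>E {1..n} \<and> inj_on \<beta> V. \<Sum>\<gamma> | \<gamma> \<in> V \<rightarrow>\<^sub>E {1..n} \<and> inj_on \<gamma> V.
     indicator (copy_event E \<beta> \<inter> copy_event E \<gamma>) \<omega>)"
  by (simp add: copy_number_def power2_eq_square sum_product indicator_inter_arith)

lemma integrable_copy_number: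
  "integrable M copy_number" "integrable M (\<lambda>\<omega>. (copy_number \<omega>)\<^sup>2)"
  unfolding copy_number_square unfolding copy_number_def[abs_def]
  using copy_event_measurable[OF injectionsD]
  by (auto intro!: Bochner_Integration.integrable_sum simp: emeasure_eq_measure)

text \<open>The variance is a sum of covariances over pairs of injections. Disjoint pairs cancel,
  and for the others the product of probabilities is dropped and the overlap bound applied. The
  excess \<open>c ^ j - 0 ^ j\<close> treats both cases at once and can be summed in closed form
  over all maps.\<close>

lemma variance_copy_number_le:
  assumes bal: "strongly_balanced V E" "card V \<ge> 2" and n: "card V \<le> n"
  shows "variance copy_number \<le> card {\<beta> \<in> V \<rightarrow>\<^sub>E {1..n}. inj_on \<beta> V} * q ^ (2 * card E) *
     ((real n - card V + card V * q powr - (card E / card V)) ^ card V - (real n - card V) ^ card V)"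
proof -
  let ?I = "{\<beta> \<in> V \<rightarrow>\<^sub>E {1..n}. inj_on \<beta> V}"
  let ?A = "copy_event E"
  define c where "c = q powr - (card E / card V)"
  let ?R = "(real n - card V + card V * c) ^ card V - (real n - card V) ^ card V"
  have finV: "finite V"
    using graph by (simp add: simple_graph_def)
  have A: "?A \<beta> \<in> sets M" if "\<beta> \<in> ?I" for \<beta>
    by (intro copy_event_measurable injectionsD that)
  have second: "expectation (\<lambda>\<omega>. (copy_number \<omega>)\<^sup>2) = (\<Sum>\<beta>\<in>?I. \<Sum>\<gamma>\<in>?I. prob (?A \<beta> \<inter> ?A \<gamma>))"
    unfolding copy_number_square using A
    by (subst Bochner_Integration.integral_sum;
        (intro sum.cong Bochner_Integration.integrable_sum refl)?;
        (subst Bochner_Integration.integral_sum)?) (auto simp: emeasure_eq_measure)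
  have first: "expectation copy_number = (\<Sum>\<beta>\<in>?I. prob (?A \<beta>))"
    unfolding copy_number_def[abs_def] using A
    by (subst Bochner_Integration.integral_sum) (auto simp: emeasure_eq_measure)
  have "variance copy_number
      = (\<Sum>\<beta>\<in>?I. \<Sum>\<gamma>\<in>?I. prob (?A \<beta> \<inter> ?A \<gamma>) - prob (?A \<beta>) * prob (?A \<gamma>))"
    unfolding variance_eq[OF integrable_copy_number]
    unfolding first second
    by (simp only: power2_eq_square sum_product sum_subtractf)
  also have "\<dots> \<le> (\<Sum>\<beta>\<in>?I. q ^ (2 * card E) * ?R)"
  proof (rule sum_mono)
    fix \<beta> assume \<beta>: "\<beta> \<in> ?I"
    let ?j = "\<lambda>\<gamma>. card {v \<in> V. \<gamma> v \<in> \<beta> ` V}"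
    \<comment> \<open>\<open>0 ^ 0 = 1\<close>, so \<open>0 ^ j\<close> is the indicator of vertex-disjointness\<close>
    have "(\<Sum>\<gamma>\<in>?I. prob (?A \<beta> \<inter> ?A \<gamma>) - prob (?A \<beta>) * prob (?A \<gamma>))
        \<le> (\<Sum>\<gamma>\<in>?I. q ^ (2 * card E) * (c ^ ?j \<gamma> - 0 ^ ?j \<gamma>))"
    proof (rule sum_mono)
      fix \<gamma> assume \<gamma>: "\<gamma> \<in> ?I"
      show "prob (?A \<beta> \<inter> ?A \<gamma>) - prob (?A \<beta>) * prob (?A \<gamma>)
          \<le> q ^ (2 * card E) * (c ^ ?j \<gamma> - 0 ^ ?j \<gamma>)"
      proof (cases "?j \<gamma> = 0")
        case True
        then have avoid: "\<gamma> v \<notin> \<beta> ` V" if "v \<in> V" for v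
          using that finV by auto
        have "\<beta> ` V \<inter> \<gamma> ` V = {}"
        proof (rule equals0I)
          fix y assume "y \<in> \<beta> ` V \<inter> \<gamma> ` V"
          then obtain v where "v \<in> V" "y = \<gamma> v" "y \<in> \<beta> ` V"
            by (elim IntE imageE) simp
          then show False
            using avoid[of v] by simp
        qed
        then have "prob (?A \<beta> \<inter> ?A \<gamma>) = prob (?A \<beta>) * prob (?A \<gamma>)"
          by (rule prob_copy_event_disjoint[OF injectionsD[OF \<beta>] injectionsD[OF \<gamma>]])
        then show ?thesis
          by (simp only: True power_0 diff_self mult_zero_right order_refl)
      next
        case False
        have "prob (?A \<beta> \<inter> ?A \<gamma>) \<le> q ^ (2 * card E) * c ^ ?j \<gamma>"
          unfolding c_def by (rule prob_copy_event_overlap[OF injectionsD[OF \<beta>] injectionsD[OF \<gamma>] bal])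
        moreover have "0 \<le> prob (?A \<beta>) * prob (?A \<gamma>)"
          by simp
        moreover have "(0::real) ^ ?j \<gamma> = 0"
          using False by (simp only: power_0_left if_False)
        ultimately show ?thesis
          by (simp only: diff_zero)
      qed
    qed
    \<comment> \<open>Passing from injections to all maps adds only nonnegative terms: the excess is
      0 for \<open>j = 0\<close> and \<open>c ^ j\<close> otherwise.\<close>
    also have "\<dots> \<le> (\<Sum>\<gamma>\<in>V \<rightarrow>\<^sub>E {1..n}. q ^ (2 * card E) * (c ^ ?j \<gamma> - 0 ^ ?j \<gamma>))"
    proof (intro sum_mono2 finite_PiE mult_nonneg_nonneg)
      show "0 \<le> c ^ m - 0 ^ m" for m
        by (cases m) (simp_all add: c_def)
    qed (use finV q_bounds in auto)
    also have "\<dots> = q ^ (2 * card E) * ((\<Sum>\<gamma>\<in>V \<rightarrow>\<^sub>E {1..n}. c ^ ?j \<gamma>) - (\<Sum>\<gamma>\<in>V \<rightarrow>\<^sub>E {1..n}. 0 ^ ?j \<gamma>))"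
      by (simp only: sum_distrib_left sum_subtractf right_diff_distrib)
    also have "\<dots> = q ^ (2 * card E) * ?R"
    proof -
      \<comment> \<open>The factorised sum is used with \<open>B\<close> the image of \<beta>, once
        for \<open>c\<close> and once for \<open>0\<close>.\<close>
      have \<beta>V: "\<beta> ` V \<subseteq> {1..n}" "card (\<beta> ` V) = card V"
        using injectionsD[OF \<beta>] by (auto simp: card_image)
      then have diff: "real (card ({1..n} - \<beta> ` V)) = real n - real (card V)"
        using n finV by (simp add: card_Diff_subset of_nat_diff)
      show ?thesis
        unfolding sum_PiE_power_card[OF finV finite_atLeastAtMost \<beta>V(1)] \<beta>V(2) diff by simp
    qed
    finally show "(\<Sum>\<gamma>\<in>?I. prob (?A \<beta> \<inter> ?A \<gamma>) - prob (?A \<beta>) * prob (?A \<gamma>))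
        \<le> q ^ (2 * card E) * ?R" .
  qed
  finally show ?thesis
    by (simp add: c_def mult.assoc)
qed

text \<open>If the copy number is 0, it deviates from its mean by the full mean, so Chebyshev's
  inequality applies with the mean as threshold. The factor \<open>q ^ (2 * card E)\<close> cancels
  against the squared mean.\<close>

lemma prob_no_copy_le:
  assumes bal: "strongly_balanced V E" "card V \<ge> 2" and n: "card V \<le> n"
    and pos: "hom_density \<mu> H V E > 0"
  shows "prob {\<omega> \<in> space M. copy_number \<omega> = 0} \<le>
    ((real n - card V + card V * q powr - (card E / card V)) ^ card V - (real n - card V) ^ card V)
      / card {\<beta> \<in> V \<rightarrow>\<^sub>E {1..n}. inj_on \<beta> V} / (hom_density \<mu> H V E)\<^sup>2"
proof -
  let ?I = "{\<beta> \<in> V \<rightarrow>\<^sub>E {1..n}. inj_on \<beta> V}"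
  let ?R = "(real n - card V + card V * q powr - (card E / card V)) ^ card V - (real n - card V) ^ card V"
  have finV: "finite V"
    using graph by (simp add: simple_graph_def)
  \<comment> \<open>An injection exists because \<open>card V \<le> n\<close>; this makes the mean
    positive.\<close>
  have "?I \<noteq> {}"
  proof -
    obtain f where "f ` V \<subseteq> {1..n}" "inj_on f V"
      using n finV card_le_inj[of V "{1..n}"] by auto
    then have "restrict f V \<in> ?I"
      by (auto simp: inj_on_def)
    then show ?thesis by blast
  qed
  then have m: "real (card ?I) > 0"
    using finite_injections by (simp add: card_gt_0_iff)
  let ?\<mu> = "expectation copy_number"
  have E_pos: "?\<mu> > 0"
    using m pos q_bounds by (simp add: expectation_copy_number)
  have meas: "random_variable borel copy_number"
    using integrable_copy_number(1) by (rule borel_measurable_integrable)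
  have "prob {\<omega> \<in> space M. copy_number \<omega> = 0} \<le> prob {\<omega> \<in> space M. \<bar>copy_number \<omega> - ?\<mu>\<bar> \<ge> ?\<mu>}"
    using E_pos meas by (intro finite_measure_mono) auto
  also have "\<dots> \<le> variance copy_number / ?\<mu>\<^sup>2"
    using E_pos by (intro Chebyshev_inequality meas integrable_copy_number)
  also have "\<dots> \<le> (card ?I * q ^ (2 * card E) * ?R) / ?\<mu>\<^sup>2"
    by (intro divide_right_mono variance_copy_number_le assms) simp
  also have "\<dots> = ?R / card ?I / (hom_density \<mu> H V E)\<^sup>2"
    using m pos q_bounds
    by (simp add: expectation_copy_number power2_eq_square power_mult_distrib mult_2 power_add divide_simps)
  finally show ?thesis .
qed

text \<open>Union bound over all injections.\<close>

lemma prob_no_copy_ge: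
  "1 - card {\<beta> \<in> V \<rightarrow>\<^sub>E {1..n}. inj_on \<beta> V} * q ^ card E
     \<le> prob {\<omega> \<in> space M. copy_number \<omega> = 0}"
proof -
  let ?I = "{\<beta> \<in> V \<rightarrow>\<^sub>E {1..n}. inj_on \<beta> V}"
  have A: "copy_event E \<beta> \<in> sets M" if "\<beta> \<in> ?I" for \<beta>
    by (intro copy_event_measurable injectionsD that)
  have "copy_number \<omega> = 0 \<longleftrightarrow> (\<forall>\<beta>\<in>?I. indicator (copy_event E \<beta>) \<omega> = (0::real))" for \<omega>
    unfolding copy_number_def by (intro sum_nonneg_eq_0_iff finite_injections) simp
  then have eq: "{\<omega> \<in> space M. copy_number \<omega> = 0} = space M - (\<Union>\<beta>\<in>?I. copy_event E \<beta>)"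
    by (auto simp: indicator_def)
  have "prob (\<Union>\<beta>\<in>?I. copy_event E \<beta>) \<le> (\<Sum>\<beta>\<in>?I. prob (copy_event E \<beta>))"
    using finite_injections A by (intro finite_measure_subadditive_finite) auto
  also have "\<dots> \<le> (\<Sum>\<beta>\<in>?I. q ^ card E)"
    by (intro sum_mono prob_copy_event_le injectionsD)
  finally show ?thesis
    unfolding eq using finite_injections A by (subst prob_compl) auto
qed

end

section \<open>Positivity of the density and the link to the subgraph count\<close>

text \<open>By contraposition: a nonnegative function with integral 0 has, by Tonelli, almost all of
  its one-coordinate sections of integral 0. Hence each projection vanishes almost everywhere, their
  sum at \<open>X 1\<close> is almost surely 0, and so is its variance.\<close>

lemma hom_density_pos:
  assumes n: "n \<ge> 1" and graph: "simple_graph {1..k} EG"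
    and var: "variance (\<lambda>\<omega>. \<Sum>l = 1..k. proj_kernel \<mu> H q k EG l (X 1 \<omega>)) > 0"
  shows "hom_density \<mu> H {1..k} EG > 0"
proof (rule ccontr)
  assume not_pos: "\<not> hom_density \<mu> H {1..k} EG > 0"
  have X1: "random_variable borel (X 1)" and distr: "distr M borel (X 1) = \<mu>"
    using n by (auto intro: points_measurable points_distr)
  interpret \<mu>: prob_space \<mu>
    using prob_space_distr[OF X1] by (simp only: distr)
  interpret product_sigma_finite "\<lambda>_::nat. \<mu>"
    by standard
  have [measurable_cong]: "sets \<mu> = sets borel"
    unfolding distr[symmetric] by simp
  interpret P: prob_space "Pi\<^sub>M {1..k} (\<lambda>_. \<mu>)"
    by (intro prob_space_PiM \<mu>.prob_space_axioms)
  define f where "f y = (\<Prod>e\<in>EG. edge_val H y e)" for y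
  have f_bounds: "0 \<le> f y" "f y \<le> 1" for y
    by (auto simp: f_def intro!: prod_nonneg prod_le_1 edge_val_bounds)
  have f_meas: "f \<in> borel_measurable (Pi\<^sub>M {1..k} (\<lambda>_. \<mu>))"
    unfolding f_def[abs_def]
  proof (intro borel_measurable_prod edge_val_measurable[where X="\<lambda>i y. y i"] H_measurable)
    fix e i assume "e \<in> EG" "i \<in> e"
    then have "i \<in> {1..k}"
      using graph unfolding simple_graph_def by blast
    then show "(\<lambda>y. y i) \<in> borel_measurable (Pi\<^sub>M {1..k} (\<lambda>_. \<mu>))"
      by measurable
  qed (use graph in \<open>auto simp: simple_graph_def\<close>)
  have "(\<integral>\<^sup>+y. ennreal (f y) \<partial>Pi\<^sub>M {1..k} (\<lambda>_. \<mu>)) = ennreal (hom_density \<mu> H {1..k} EG)"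
    unfolding hom_density_def f_def[symmetric] using f_bounds f_meas
    by (intro nn_integral_eq_integral P.integrable_const_bound[where B=1]) auto
  \<comment> \<open>\<open>ennreal\<close> sends negative reals to 0, so the negated claim is
    enough.\<close>
  then have zero: "(\<integral>\<^sup>+y. ennreal (f y) \<partial>Pi\<^sub>M {1..k} (\<lambda>_. \<mu>)) = 0"
    using not_pos by (simp add: ennreal_neg)
  have "AE x in \<mu>. proj_kernel \<mu> H q k EG l x = 0" if l: "l \<in> {1..k}" for l
  proof -
    let ?P = "Pi\<^sub>M ({1..k} - {l}) (\<lambda>_. \<mu>)"
    interpret Q: prob_space ?P
      by (intro prob_space_PiM \<mu>.prob_space_axioms)
    have ins: "insert l ({1..k} - {l}) = {1..k}"
      using l by auto
    have upd: "(\<lambda>(x, y). y(l := x)) \<in> \<mu> \<Otimes>\<^sub>M ?P \<rightarrow>\<^sub>M Pi\<^sub>M {1..k} (\<lambda>_. \<mu>)"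
      unfolding split_beta' using l by (intro measurable_fun_upd[where J="{1..k} - {l}"]) auto
    have [measurable]: "(\<lambda>(x, y). f (y(l := x))) \<in> borel_measurable (\<mu> \<Otimes>\<^sub>M ?P)"
      using measurable_compose[OF upd f_meas] by (simp add: split_beta')
    \<comment> \<open>Tonelli with coordinate \<open>l\<close> outermost.\<close>
    have "(\<integral>\<^sup>+x. (\<integral>\<^sup>+y. ennreal (f (y(l := x))) \<partial>?P) \<partial>\<mu>) = 0"
      using product_nn_integral_insert_rev[of "{1..k} - {l}" l "\<lambda>y. ennreal (f y)", unfolded ins]
        zero f_meas
      by simp
    moreover have "(\<lambda>x. \<integral>\<^sup>+y. ennreal (f (y(l := x))) \<partial>?P) \<in> borel_measurable \<mu>"
      using measurable_compose[OF measurable_compose[OF upd f_meas] measurable_ennreal]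
      by (intro Q.borel_measurable_nn_integral) (simp add: split_beta')
    ultimately have "AE x in \<mu>. (\<integral>\<^sup>+y. ennreal (f (y(l := x))) \<partial>?P) = 0"
      by (simp only: nn_integral_0_iff_AE)
    then show ?thesis
    proof eventually_elim
      case (elim x)
      \<comment> \<open>Going through almost everywhere vanishing turns the zero nonnegative
        integral into the zero Bochner integral used by \<open>proj_kernel\<close>.\<close>
      have "AE y in ?P. f (y(l := x)) = 0"
      proof -
        have "x \<in> space \<mu>"
          using sets_eq_imp_space_eq[OF \<open>sets \<mu> = sets borel\<close>] by simp
        then have "(\<lambda>y. f (y(l := x))) \<in> borel_measurable ?P"
          by measurable
        then have "(\<lambda>y. ennreal (f (y(l := x)))) \<in> borel_measurable ?P"
          by (rule measurable_compose[OF _ measurable_ennreal])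
        then have "AE y in ?P. ennreal (f (y(l := x))) = 0"
          using elim by (simp only: nn_integral_0_iff_AE)
        then show ?thesis
          by eventually_elim (simp add: ennreal_eq_0_iff antisym f_bounds)
      qed
      then have "(\<integral>y. f (y(l := x)) \<partial>?P) = 0"
        by (rule integral_eq_zero_AE)
      then show ?case
        by (simp add: proj_kernel_def f_def)
    qed
  qed
  then have "AE x in \<mu>. \<forall>l\<in>{1..k}. proj_kernel \<mu> H q k EG l x = 0"
    by (intro AE_finite_allI) auto
  then have "AE x in distr M borel (X 1). (\<Sum>l = 1..k. proj_kernel \<mu> H q k EG l x) = 0"
    unfolding distr by eventually_elim simp
  then have ae: "AE \<omega> in M. (\<Sum>l = 1..k. proj_kernel \<mu> H q k EG l (X 1 \<omega>)) = 0"
    by (rule AE_distrD[OF X1])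
  then have mean: "expectation (\<lambda>\<omega>. \<Sum>l = 1..k. proj_kernel \<mu> H q k EG l (X 1 \<omega>)) = 0"
    by (rule integral_eq_zero_AE)
  from ae have "expectation (\<lambda>\<omega>. (\<Sum>l = 1..k. proj_kernel \<mu> H q k EG l (X 1 \<omega>))\<^sup>2) = 0"
    by (intro integral_eq_zero_AE) simp
  then show False
    using var unfolding mean by simp
qed

text \<open>\<open>copy_number\<close> is the \<open>T\<close> of the introduction, and
  \<open>subgraph_count\<close> divides it by the number of automorphisms; both vanish exactly when
  no injection yields a copy.\<close>

lemma count_zero_event:
  assumes graph: "simple_graph {1..k} EG" and "k > 0"
  shows "{\<omega> \<in> space M. subgraph_count k EG n (edges \<omega>) = 0}
    = {\<omega> \<in> space M. copy_number {1..k} EG \<omega> = 0}"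
proof (intro Collect_cong conj_cong refl)
  have V_ne: "{1..k} \<noteq> {}"
    using \<open>k > 0\<close> by simp
  fix \<omega> assume \<omega>: "\<omega> \<in> space M"
  let ?I = "{\<beta>. \<beta> \<in> {1..k} \<rightarrow>\<^sub>E {1..n} \<and> inj_on \<beta> {1..k}}"
  have "copy_number {1..k} EG \<omega> = 0 \<longleftrightarrow> (\<forall>\<beta>\<in>?I. indicator (copy_event EG \<beta>) \<omega> = (0::real))"
    unfolding copy_number_def[OF graph V_ne]
    by (intro sum_nonneg_eq_0_iff finite_injections[OF graph V_ne]) simp
  then show "subgraph_count k EG n (edges \<omega>) = 0 \<longleftrightarrow> copy_number {1..k} EG \<omega> = 0"
    using \<omega> unfolding subgraph_count_eq_0_iff[OF simple_graph_finite_edges[OF graph]]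
    by (simp add: copy_event_def indicator_def)
qed

end

section \<open>The threshold\<close>

theorem corollary7p11:
  fixes \<mu> :: "(real ^ 'd) measure"
    and H :: "real ^ 'd \<Rightarrow> real ^ 'd \<Rightarrow> real"
    and p :: "nat \<Rightarrow> real"
    and M :: "nat \<Rightarrow> 'w measure"
    and X :: "nat \<Rightarrow> nat \<Rightarrow> 'w \<Rightarrow> real ^ 'd"
    and edges :: "nat \<Rightarrow> 'w \<Rightarrow> nat set set"
    and k :: nat
    and EG :: "nat set set"
  assumes "prob_space \<mu>" and "sets \<mu> = sets borel" and "\<And>x. emeasure \<mu> {x} = 0"
    and "(\<lambda>(x, y). H x y) \<in> borel_measurable (borel \<Otimes>\<^sub>M borel)"
    and "\<And>x y. H x y = H y x" and "\<And>x y. 0 \<le> H x y \<and> H x y \<le> 1"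
    and "\<And>n. n \<ge> 1 \<Longrightarrow> 0 < p n \<and> p n < 1"
    and "\<And>n. n \<ge> 1 \<Longrightarrow> binomial_rcm (M n) n (X n) (edges n) \<mu> H (p n)"
    and "k \<ge> 2" and "simple_graph {1..k} EG" and "connected_graph {1..k} EG"
    and "strongly_balanced {1..k} EG"
    and "\<And>n. n \<ge> 1 \<Longrightarrow>
      prob_space.variance (M n) (\<lambda>\<omega>. \<Sum>l = 1..k. proj_kernel \<mu> H (p n) k EG l (X n 1 \<omega>)) > 0"
  shows
    "(much_less p (\<lambda>n. real n powr (- (real k / real (card EG)))) \<longrightarrow>
       (\<lambda>n. measure (M n) {\<omega> \<in> space (M n). subgraph_count k EG n (edges n \<omega>) = 0}) \<longlonglongrightarrow> 1)
     \<and> (much_less (\<lambda>n. real n powr (- (real k / real (card EG)))) p \<longrightarrow>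
       (\<lambda>n. measure (M n) {\<omega> \<in> space (M n). subgraph_count k EG n (edges n \<omega>) = 0}) \<longlonglongrightarrow> 0)"
proof (intro conjI impI)
  let ?e = "card EG"
  let ?P = "\<lambda>n. measure (M n) {\<omega> \<in> space (M n). subgraph_count k EG n (edges n \<omega>) = 0}"
  let ?I = "\<lambda>n. {\<beta> \<in> {1..k} \<rightarrow>\<^sub>E {1..n}. inj_on \<beta> {1..k}}"
  note p = assms(7) and k = \<open>k \<ge> 2\<close> and graph = \<open>simple_graph {1..k} EG\<close>
  have rcm: "symmetric_rcm (M n) n (X n) (edges n) \<mu> H (p n)" if "n \<ge> 1" for n
    using assms(4-6) assms(7,8)[OF that] by (intro symmetric_rcm.intro symmetric_rcm_axioms.intro) auto
  have V: "{1..k} \<noteq> {}" "card {1..k} = k"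
    using k by auto
  have prob: "prob_space (M n)" if "n \<ge> 1" for n
    using assms(8)[OF that] by (rule binomial_rcm.axioms(1))
  \<comment> \<open>Connectedness with at least two vertices forces an edge, so the exponent
    \<open>k / e\<close> is a genuine quotient.\<close>
  have "EG \<noteq> {}"
  proof
    assume "EG = {}"
    moreover have "(1, 2) \<in> {(a, b). {a, b} \<in> EG}\<^sup>*"
      using \<open>connected_graph {1..k} EG\<close> k by (auto simp: connected_graph_def)
    ultimately show False by simp
  qed
  then have e: "?e > 0"
    using simple_graph_finite_edges[OF graph] by (simp add: card_gt_0_iff)
  {
    assume "much_less p (\<lambda>n. real n powr (- (real k / real ?e)))"
    \<comment> \<open>The union bound \<open>n ^ k * p n ^ e\<close> is the \<open>e\<close>-th
      power of the ratio that tends to 0 by hypothesis.\<close>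
    then have "(\<lambda>n. 1 - (p n / real n powr (- (real k / real ?e))) ^ ?e) \<longlonglongrightarrow> 1 - 0 ^ ?e"
      unfolding much_less_def by (intro tendsto_intros) auto
    then have lim: "(\<lambda>n. 1 - (p n / real n powr (- (real k / real ?e))) ^ ?e) \<longlonglongrightarrow> 1"
      using e by (simp add: power_0_left)
    have "\<forall>\<^sub>F n in sequentially. 1 - (p n / real n powr (- (real k / real ?e))) ^ ?e \<le> ?P n"
      using eventually_ge_at_top[of 1]
    proof eventually_elim
      case (elim n)
      interpret symmetric_rcm "M n" n "X n" "edges n" \<mu> H "p n"
        by (rule rcm[OF elim])
      have "(real n powr (- (real k / real ?e))) ^ ?e = real n powr (- real k)"
        using e elim by (simp add: powr_powr flip: powr_realpow)
      then have "(p n / real n powr (- (real k / real ?e))) ^ ?e = p n ^ ?e / real n powr (- real k)"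
        by (simp only: power_divide)
      also have "\<dots> = real n ^ k * p n ^ ?e"
        using elim by (simp add: powr_minus powr_realpow divide_inverse)
      finally have "(p n / real n powr (- (real k / real ?e))) ^ ?e = real n ^ k * p n ^ ?e" .
      moreover have "real (card (?I n)) * p n ^ ?e \<le> real n ^ k * p n ^ ?e"
        using card_injections_le[of k n] p[OF elim]
        by (intro mult_right_mono) (simp_all only: of_nat_power[symmetric] of_nat_le_iff, simp)
      ultimately show ?case
        using prob_no_copy_ge[OF graph V(1)] k by (subst count_zero_event[OF graph]) auto
    qed
    moreover have "\<forall>\<^sub>F n in sequentially. ?P n \<le> 1"
      using eventually_ge_at_top[of 1]
      by eventually_elim (rule prob_space.prob_le_1[OF prob])
    ultimately show "?P \<longlonglongrightarrow> 1"
      by (rule tendsto_sandwich[OF _ _ lim tendsto_const])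
  next
    assume ml: "much_less (\<lambda>n. real n powr (- (real k / real ?e))) p"
    let ?h = "hom_density \<mu> H {1..k} EG"
    let ?r = "\<lambda>n. ((real n - real k + real k * p n powr - (real ?e / real k)) ^ k - (real n - real k) ^ k)
     / real (card (?I n))"
    \<comment> \<open>The density does not depend on \<open>n\<close>, so its positivity is derived
      once, from the model with \<open>n = 1\<close>.\<close>
    have h: "?h > 0"
      using symmetric_rcm.hom_density_pos[OF rcm[OF order_refl] order_refl graph
        assms(13)[OF order_refl]] .
    have "(\<lambda>n. ?r n / ?h\<^sup>2) \<longlonglongrightarrow> 0 / ?h\<^sup>2"
      using h k e p ml by (intro tendsto_divide overlap_sum_tendsto tendsto_const) auto
    then have lim: "(\<lambda>n. ?r n / ?h\<^sup>2) \<longlonglongrightarrow> 0"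
      by simp
    have "\<forall>\<^sub>F n in sequentially. ?P n \<le> ?r n / ?h\<^sup>2"
      \<comment> \<open>The second-moment bound requires \<open>n \<ge> k\<close>, so that
        injections exist.\<close>
      using eventually_ge_at_top[of k]
    proof eventually_elim
      case (elim n)
      then have "n \<ge> 1"
        using k by simp
      interpret symmetric_rcm "M n" n "X n" "edges n" \<mu> H "p n"
        by (rule rcm[OF \<open>n \<ge> 1\<close>])
      show ?case
        using prob_no_copy_le[OF graph V(1) \<open>strongly_balanced {1..k} EG\<close>, unfolded V(2), OF k elim h] k
        by (subst count_zero_event[OF graph]) auto
    qed
    then show "?P \<longlonglongrightarrow> 0"
      by (intro tendsto_sandwich[OF always_eventually _ tendsto_const lim]) auto
  }
qed

end
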